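(* Let $\mathscr{F}$ be the smallest family of trees that contains the four trees $P_2$, $P_3$, $P_4$ and $K_{1,3}$ and is closed under the following three operations, in each of which $T_1,\dots,T_p$ are vertex-disjoint trees in $\mathscr{F} \cap \mathscr{T}_{min}$, $S_i$ is a minimum RED:LD set of $T_i$, $S = \bigcup_i S_i$, and $w$ is a new vertex: (a) ($p=2$) if $|V(T_1)| \equiv |V(T_2)| \equiv 2 \pmod 3$, add $w$ and edges $ww_1, ww_2$ with $w_1 \in S_1$, $w_2 \in S_2$; (b) ($p=2$) if $|V(T_1)| \equiv 0$ and $|V(T_2)| \equiv 2 \pmod 3$, add $w$ and edges $ww_1, ww_2$ with $w_1 \in S_1$, $w_2 \in S_2$; (c) if $(|V(T_1)|,\dots,|V(T_p)|) \bmod 3$ equals $(0,0)$, $(1,2)$ or $(2,2,2)$, add $w$ adjacent to exactly one vertex of each $T_i$, chosen so that $|N(w) \cap S| \ge 2$. Then $\mathscr{F} = \mathscr{T}_{min}$.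
   Context: $N(v)$ denotes the open neighborhood of $v$. A set $S \subseteq V(G)$ is a locating-dominating (LD) set if for all $u,v \in V(G)-S$: $N(v)\cap S \neq \varnothing$, and if $u \ne v$ then $N(v) \cap S \neq N(u) \cap S$. A RED:LD set is an LD set $S$ such that $S-\{v\}$ is an LD set for every $v \in S$; a minimum RED:LD set is one of minimum cardinality, and $\textrm{RED:LD}(G)$ is that cardinality. $\mathscr{T}_{min}$ is the family of all trees $T$ of order $n \ge 2$ with $\textrm{RED:LD}(T) = \lceil (2n+2)/3 \rceil$. $P_k$ is the path on $k$ vertices and $K_{1,3}$ the star with three leaves. *)

theory Defs
  imports Complex_Main
begin

record 'a graph =
  verts :: "'a set"
  edges :: "'a set set"

definition simple_graph :: "'a graph \<Rightarrow> bool" where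
  "simple_graph G \<longleftrightarrow> finite (verts G) \<and> (\<forall>e\<in>edges G. e \<subseteq> verts G \<and> card e = 2)"

definition adj :: "'a graph \<Rightarrow> 'a \<Rightarrow> 'a \<Rightarrow> bool" where
  "adj G u v \<longleftrightarrow> {u, v} \<in> edges G"

definition nbhd :: "'a graph \<Rightarrow> 'a \<Rightarrow> 'a set" where
  "nbhd G v = {u \<in> verts G. adj G v u}"

definition connected_graph :: "'a graph \<Rightarrow> bool" where
  "connected_graph G \<longleftrightarrow> verts G \<noteq> {} \<and> (\<forall>u\<in>verts G. \<forall>v\<in>verts G. (adj G)\<^sup>*\<^sup>* u v)"

definition is_cycle :: "'a graph \<Rightarrow> 'a list \<Rightarrow> bool" where
  "is_cycle G c \<longleftrightarrow> length c \<ge> 3 \<and> distinct c \<and>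
     (\<forall>i<length c. adj G (c ! i) (c ! (Suc i mod length c)))"

definition tree :: "'a graph \<Rightarrow> bool" where
  "tree G \<longleftrightarrow> simple_graph G \<and> connected_graph G \<and> (\<nexists>c. is_cycle G c)"

definition graph_iso :: "'a graph \<Rightarrow> 'b graph \<Rightarrow> bool" where
  "graph_iso G H \<longleftrightarrow> (\<exists>f. bij_betw f (verts G) (verts H) \<and> edges H = (\<lambda>e. f ` e) ` edges G)"

definition path_graph :: "nat \<Rightarrow> nat graph" where
  "path_graph k = \<lparr>verts = {..<k}, edges = {{i, Suc i} | i. Suc i < k}\<rparr>"

definition star_graph :: "nat \<Rightarrow> nat graph" where
  "star_graph m = \<lparr>verts = {..m}, edges = {{0, i} | i. i \<in> {1..m}}\<rparr>"

definition ld_set :: "'a graph \<Rightarrow> 'a set \<Rightarrow> bool" where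
  "ld_set G S \<longleftrightarrow> S \<subseteq> verts G \<and>
     (\<forall>u\<in>verts G - S. \<forall>v\<in>verts G - S.
        nbhd G v \<inter> S \<noteq> {} \<and> (u \<noteq> v \<longrightarrow> nbhd G v \<inter> S \<noteq> nbhd G u \<inter> S))"

definition red_ld_set :: "'a graph \<Rightarrow> 'a set \<Rightarrow> bool" where
  "red_ld_set G S \<longleftrightarrow> ld_set G S \<and> (\<forall>v\<in>S. ld_set G (S - {v}))"

definition min_red_ld_set :: "'a graph \<Rightarrow> 'a set \<Rightarrow> bool" where
  "min_red_ld_set G S \<longleftrightarrow> red_ld_set G S \<and> (\<forall>S'. red_ld_set G S' \<longrightarrow> card S \<le> card S')"

text \<open>In a tree of order at least 2 the whole vertex set is a RED:LD set, so the minimum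
  below is attained.\<close>

definition RED_LD :: "'a graph \<Rightarrow> nat" where
  "RED_LD G = (LEAST k. \<exists>S. red_ld_set G S \<and> card S = k)"

definition T_min :: "'a graph set" where
  "T_min = {T. tree T \<and> card (verts T) \<ge> 2 \<and>
     int (RED_LD T) = \<lceil>(2 * real (card (verts T)) + 2) / 3\<rceil>}"

definition attach :: "'a \<Rightarrow> 'a graph list \<Rightarrow> 'a list \<Rightarrow> 'a graph" where
  "attach w Ts xs =
     \<lparr>verts = insert w (\<Union>T\<in>set Ts. verts T),
      edges = (\<Union>T\<in>set Ts. edges T) \<union> {{w, x} | x. x \<in> set xs}\<rparr>"

text \<open>Graphs are labelled by vertices of type \<^typ>\<open>'a\<close>. The base trees are taken in all
  their isomorphic copies, and the operations apply to any disjoint labelled trees.\<close>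

inductive_set tree_family :: "'a graph set" where
  P2: "graph_iso (path_graph 2) T \<Longrightarrow> T \<in> tree_family"
| P3: "graph_iso (path_graph 3) T \<Longrightarrow> T \<in> tree_family"
| P4: "graph_iso (path_graph 4) T \<Longrightarrow> T \<in> tree_family"
| K13: "graph_iso (star_graph 3) T \<Longrightarrow> T \<in> tree_family"
| op_a: "\<lbrakk>T1 \<in> tree_family; T1 \<in> T_min; T2 \<in> tree_family; T2 \<in> T_min;
     verts T1 \<inter> verts T2 = {}; w \<notin> verts T1 \<union> verts T2;
     min_red_ld_set T1 S1; min_red_ld_set T2 S2;
     card (verts T1) mod 3 = 2; card (verts T2) mod 3 = 2;
     w1 \<in> S1; w2 \<in> S2\<rbrakk>
   \<Longrightarrow> attach w [T1, T2] [w1, w2] \<in> tree_family"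
| op_b: "\<lbrakk>T1 \<in> tree_family; T1 \<in> T_min; T2 \<in> tree_family; T2 \<in> T_min;
     verts T1 \<inter> verts T2 = {}; w \<notin> verts T1 \<union> verts T2;
     min_red_ld_set T1 S1; min_red_ld_set T2 S2;
     card (verts T1) mod 3 = 0; card (verts T2) mod 3 = 2;
     w1 \<in> S1; w2 \<in> S2\<rbrakk>
   \<Longrightarrow> attach w [T1, T2] [w1, w2] \<in> tree_family"
| op_c: "\<lbrakk>length Ss = length Ts; length xs = length Ts;
     \<forall>i<length Ts. Ts ! i \<in> tree_family \<and> Ts ! i \<in> T_min \<and>
       min_red_ld_set (Ts ! i) (Ss ! i) \<and> xs ! i \<in> verts (Ts ! i);
     \<forall>i<length Ts. \<forall>j<length Ts. i \<noteq> j \<longrightarrow> verts (Ts ! i) \<inter> verts (Ts ! j) = {};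
     \<forall>i<length Ts. w \<notin> verts (Ts ! i);
     map (\<lambda>T. card (verts T) mod 3) Ts \<in> {[0, 0], [1, 2], [2, 2, 2]};
     card (nbhd (attach w Ts xs) w \<inter> (\<Union>S\<in>set Ss. S)) \<ge> 2\<rbrakk>
   \<Longrightarrow> attach w Ts xs \<in> tree_family"

end

theory Submission
  imports Defs "HOL-Library.Transitive_Closure_Table"
begin

text \<open>In a tree, a RED:LD set is the same as a set S such that every vertex outside S has at least
  two neighbours in S and every vertex of S has at least one. If w is a vertex outside S, such a
  set restricts to a set of the same kind on each component of the tree minus w, and there are at
  least two components. By induction 3|S| \<ge> 2n + 2. If d is the degree of w, the excesses
  3|S| - 2n - 2 of the components add up to the excess of the whole tree plus 4 - 2d. A tree lies
  in the extremal family iff some S has excess at most 2, so then all components are extremal and d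
  is 2 or 3; since the excess determines n modulo 3, the distributions of the excess over the
  components are exactly the residue patterns of the three operations. If S is the whole vertex
  set, then n \<le> 4.\<close>

section \<open>Paths and cycles in trees\<close>

text \<open>The ceiling of (2n + 2)/3 is the only integer k with 3k - 2n - 2 in {0, 1, 2}, which is
  why excess at most 2 characterises \<open>T_min\<close>. As 3|S| vanishes modulo 3, the excess is
  congruent to n + 1, so excess 0, 1, 2 means n congruent to 2, 0, 1. In the balance of excesses
  every branch brings its own constant 2, while the new vertex outside S costs 2. A total of at most
  2 with at least two branches therefore leaves only the excess lists (0,0), (1,0), (1,1), (2,0) and
  (0,0,0), up to order. Read in the other direction, the same balance shows that each operation
  yields a set of excess at most 2. No exchange argument is required: a branch set of excess at most
  2 is minimum by the lower bound alone, so the restrictions of S are legitimate choices of the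
  \<open>S_i\<close>. What does need care is that the operations act on labelled trees, so a tree
  must be taken apart as an equality of graphs and not up to isomorphism.\<close>

lemma adj_commute: "adj G u v \<longleftrightarrow> adj G v u"
  by (simp add: adj_def insert_commute)

lemma simple_graph_adjD:
  assumes "simple_graph G" "adj G u v"
  shows "u \<in> verts G" "v \<in> verts G" "u \<noteq> v"
  using assms by (auto simp: simple_graph_def adj_def)

lemma treeD:
  assumes "tree G"
  shows "simple_graph G" "connected_graph G" "\<not> is_cycle G c" "finite (verts G)" "verts G \<noteq> {}"
  using assms by (auto simp: tree_def simple_graph_def connected_graph_def)

lemma tree_card_pos: "tree G \<Longrightarrow> card (verts G) \<ge> 1"
  using treeD(4,5)[of G] by (simp add: Suc_le_eq card_gt_0_iff)

lemma in_nbhd_iff: "tree G \<Longrightarrow> u \<in> nbhd G v \<longleftrightarrow> adj G v u"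
  using simple_graph_adjD(2)[OF treeD(1)] by (auto simp: nbhd_def)

text \<open>Reachability in \<open>G\<close> minus \<open>w\<close> is expressed by a relation
  instead of a subgraph; started at a neighbour of \<open>w\<close>, its closure is a component of
  what remains of a tree.\<close>

definition adj_avoiding :: "'a graph \<Rightarrow> 'a \<Rightarrow> 'a \<Rightarrow> 'a \<Rightarrow> bool" where
  "adj_avoiding G w u v \<longleftrightarrow> adj G u v \<and> u \<noteq> w \<and> v \<noteq> w"

lemma adj_avoiding_rtranclp_commute:
  "(adj_avoiding G w)\<^sup>*\<^sup>* u v \<Longrightarrow> (adj_avoiding G w)\<^sup>*\<^sup>* v u"
proof (induction rule: rtranclp_induct)
  case (step y z)
  then have "adj_avoiding G w z y"
    by (auto simp: adj_avoiding_def adj_commute)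
  then show ?case
    using step.IH by (rule converse_rtranclp_into_rtranclp)
qed simp

text \<open>A path between two neighbours of \<open>w\<close> that avoids \<open>w\<close> would
  close up to a cycle through \<open>w\<close>.\<close>

lemma tree_neighbours_separated:
  assumes "tree G" "adj G w x" "adj G w y" and path: "(adj_avoiding G w)\<^sup>*\<^sup>* x y"
  shows "x = y"
proof (rule ccontr)
  assume "x \<noteq> y"
  \<comment> \<open>\<open>rtrancl_path\<close> lists the vertices after the start, so the path is
    \<open>x # xs\<close> and the cycle will be \<open>w # x # xs\<close>.\<close>
  obtain xs where xs: "rtrancl_path (adj_avoiding G w) x xs y" "distinct (x # xs)"
    using path by (metis rtranclp_eq_rtrancl_path rtrancl_path_distinct)
  have ne: "xs \<noteq> []"
    using xs(1) \<open>x \<noteq> y\<close> by (auto elim: rtrancl_path.cases)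
  have step: "adj_avoiding G w ((x # xs) ! i) (xs ! i)" if "i < length xs" for i
    using rtrancl_path_nth[OF xs(1) that] .
  have last: "(x # xs) ! length xs = y"
    using rtrancl_path_last[OF xs(1) ne] ne by (simp add: last_conv_nth nth_Cons')
  have "w \<noteq> x"
    using simple_graph_adjD(3)[OF treeD(1)[OF assms(1)] assms(2)] .
  moreover have "w \<notin> set xs"
    using step by (auto simp: in_set_conv_nth adj_avoiding_def)
  ultimately have "distinct (w # x # xs)"
    using xs(2) by simp
  moreover have "adj G ((w # x # xs) ! i) ((w # x # xs) ! (Suc i mod length (w # x # xs)))"
    if i: "i < length (w # x # xs)" for i
  proof (cases i)
    case 0
    then show ?thesis using assms(2) by simp
  next
    case (Suc j)
    show ?thesis
    proof (cases "j < length xs")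
      case True
      then show ?thesis using Suc step[OF True] by (simp add: adj_avoiding_def)
    next
      case False
      then have "j = length xs" using i Suc by simp
      then show ?thesis using Suc last assms(3) by (simp add: adj_commute)
    qed
  qed
  ultimately have "is_cycle G (w # x # xs)"
    using ne unfolding is_cycle_def by (cases xs) auto
  then show False using treeD(3)[OF assms(1)] by blast
qed

lemma is_cycle_rotate1: "is_cycle G c \<Longrightarrow> is_cycle G (rotate1 c)"
  unfolding is_cycle_def
  by (auto simp: nth_rotate1 mod_Suc_eq)
    (metis Suc_lessD mod_less_divisor nth_rotate1 numeral_3_eq_3 less_le_trans zero_less_Suc)

lemma is_cycle_rotate: "is_cycle G c \<Longrightarrow> is_cycle G (rotate n c)"
  by (induction n) (auto intro: is_cycle_rotate1)

text \<open>Rotated to begin at \<open>w\<close>, the cycle supplies its second and its last vertex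
  as \<open>x\<close> and \<open>y\<close>; the rest of the cycle joins them. This is what makes
  acyclicity of a composed graph provable at the attaching vertex.\<close>

lemma cycle_neighbours_connected:
  assumes "is_cycle G c" "w \<in> set c"
  obtains x y where "x \<noteq> y" "adj G w x" "adj G w y" "(adj_avoiding G w)\<^sup>*\<^sup>* x y"
proof -
  obtain n where n: "n < length c" "c ! n = w"
    using assms(2) by (auto simp: in_set_conv_nth)
  define d where "d = rotate n c"
  have d: "is_cycle G d"
    using assms(1) is_cycle_rotate d_def by blast
  then have len: "length d \<ge> 3" and dist: "distinct d"
    and step: "\<And>i. i < length d \<Longrightarrow> adj G (d ! i) (d ! (Suc i mod length d))"
    by (auto simp: is_cycle_def)
  have d0: "d ! 0 = w"
    using n nth_rotate[of 0 c n] by (cases c) (auto simp: d_def)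
  have avoid: "d ! i \<noteq> w" if "0 < i" "i < length d" for i
    using that dist d0 by (metis nth_eq_iff_index_eq less_trans not_less_iff_gr_or_eq)
  have path: "(adj_avoiding G w)\<^sup>*\<^sup>* (d ! 1) (d ! Suc k)" if "Suc k < length d" for k
    using that
  proof (induction k)
    case (Suc k)
    have "adj G (d ! Suc k) (d ! Suc (Suc k))"
      using step[of "Suc k"] Suc.prems by simp
    then have "adj_avoiding G w (d ! Suc k) (d ! Suc (Suc k))"
      using avoid[of "Suc k"] avoid[of "Suc (Suc k)"] Suc.prems by (simp add: adj_avoiding_def)
    then show ?case
      using Suc.IH Suc.prems by (simp add: rtranclp.rtrancl_into_rtrancl)
  qed simp
  obtain m where m: "length d = Suc (Suc (Suc m))"
    using len by (metis Suc_le_D numeral_3_eq_3 Suc_le_mono)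
  show thesis
  proof (rule that)
    show "d ! 1 \<noteq> d ! Suc (Suc m)"
      using dist m by (simp add: nth_eq_iff_index_eq)
    show "adj G w (d ! 1)"
      using step[of 0] d0 m by simp
    show "adj G w (d ! Suc (Suc m))"
      using step[of "Suc (Suc m)"] d0 m by (simp add: adj_commute)
    show "(adj_avoiding G w)\<^sup>*\<^sup>* (d ! 1) (d ! Suc (Suc m))"
      using path m by simp
  qed
qed

lemma tree_no_triangle:
  assumes "tree G" "adj G a b" "adj G a c" "adj G b c"
  shows False
proof -
  note simple = simple_graph_adjD(3)[OF treeD(1)[OF assms(1)]]
  have "adj_avoiding G a b c"
    using assms simple by (auto simp: adj_avoiding_def)
  then show False
    using tree_neighbours_separated[OF assms(1-3)] simple[OF assms(4)] by blast
qed

text \<open>The walk from \<open>a\<close> over \<open>v\<close> to \<open>b\<close> avoids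
  \<open>u\<close>, so the two neighbours \<open>a\<close> and \<open>b\<close> of \<open>u\<close>
  would be connected off \<open>u\<close>.\<close>

lemma tree_common_neighbour_unique:
  assumes "tree G" "u \<noteq> v" "adj G u a" "adj G v a" "adj G u b" "adj G v b"
  shows "a = b"
proof -
  note simple = simple_graph_adjD(3)[OF treeD(1)[OF assms(1)]]
  have "adj_avoiding G u a v" "adj_avoiding G u v b"
    using assms simple by (auto simp: adj_avoiding_def adj_commute)
  then have "(adj_avoiding G u)\<^sup>*\<^sup>* a b"
    by auto
  then show ?thesis
    using tree_neighbours_separated[OF assms(1) assms(3,5)] by blast
qed

section \<open>Double domination\<close>

text \<open>In a simple graph this is double domination in the usual sense, |N[v] \<inter> S| \<ge>
  2 for all v: a vertex of \<open>S\<close> counts itself once.\<close>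

definition double_dominating :: "'a graph \<Rightarrow> 'a set \<Rightarrow> bool" where
  "double_dominating G S \<longleftrightarrow> S \<subseteq> verts G \<and>
     (\<forall>v\<in>verts G - S. \<exists>a\<in>S. \<exists>b\<in>S. a \<noteq> b \<and> adj G v a \<and> adj G v b) \<and>
     (\<forall>v\<in>S. \<exists>a\<in>S. adj G v a)"

lemma ld_dominates:
  assumes "ld_set G S" "v \<in> verts G - S"
  shows "\<exists>a\<in>S. adj G v a"
proof -
  have "nbhd G v \<inter> S \<noteq> {}"
    using assms unfolding ld_set_def by blast
  then show ?thesis by (auto simp: nbhd_def)
qed

text \<open>Deleting one neighbour of \<open>v\<close> in \<open>S\<close> must leave another one,
  and a vertex of \<open>S\<close> must be dominated after its own deletion.\<close>

lemma red_ld_imp_double_dominating: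
  assumes "red_ld_set G S"
  shows "double_dominating G S"
proof -
  have ld: "ld_set G S" and ld_minus: "\<And>x. x \<in> S \<Longrightarrow> ld_set G (S - {x})"
    using assms by (auto simp: red_ld_set_def)
  have "\<exists>a\<in>S. \<exists>b\<in>S. a \<noteq> b \<and> adj G v a \<and> adj G v b" if v: "v \<in> verts G - S" for v
  proof -
    obtain x where x: "x \<in> S" "adj G v x"
      using ld_dominates[OF ld v] by blast
    obtain y where "y \<in> S - {x}" "adj G v y"
      using ld_dominates[OF ld_minus[OF x(1)]] v by blast
    then show ?thesis using x by blast
  qed
  moreover have "\<exists>a\<in>S. adj G v a" if "v \<in> S" for v
    using ld_dominates[OF ld_minus[OF that], of v] ld that by (auto simp: ld_set_def)
  ultimately show ?thesis
    using ld by (auto simp: double_dominating_def ld_set_def)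
qed

text \<open>In a tree the separation conditions are automatic, because two vertices have at most one
  common neighbour and there are no triangles.\<close>

lemma double_dominating_imp_red_ld:
  assumes tree: "tree G" and S: "double_dominating G S"
  shows "red_ld_set G S"
proof -
  have sub: "S \<subseteq> verts G"
    and out: "\<And>v. v \<in> verts G \<Longrightarrow> v \<notin> S \<Longrightarrow> \<exists>a\<in>S. \<exists>b\<in>S. a \<noteq> b \<and> adj G v a \<and> adj G v b"
    and ins: "\<And>v. v \<in> S \<Longrightarrow> \<exists>a\<in>S. adj G v a"
    using S by (auto simp: double_dominating_def)
  note common = tree_common_neighbour_unique[OF tree]
  note noloop = simple_graph_adjD(3)[OF treeD(1)[OF tree]]
  have adj_eq: "adj G u a \<longleftrightarrow> adj G v a"
    if "nbhd G u \<inter> R = nbhd G v \<inter> R" "a \<in> R" for u v a R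
    using that in_nbhd_iff[OF tree] by blast
  have "ld_set G S"
    unfolding ld_set_def
  proof (intro conjI sub ballI impI)
    fix u v assume v: "v \<in> verts G - S"
    then obtain a b where ab: "a \<in> S" "b \<in> S" "a \<noteq> b" "adj G v a" "adj G v b"
      using out by blast
    then show "nbhd G v \<inter> S \<noteq> {}"
      using in_nbhd_iff[OF tree] by blast
    assume "u \<noteq> v"
    then show "nbhd G v \<inter> S \<noteq> nbhd G u \<inter> S"
      using ab common[of u v a b] adj_eq[of v S u] by blast
  qed
  moreover have "ld_set G (S - {x})" if x: "x \<in> S" for x
    unfolding ld_set_def
  proof (intro conjI ballI impI)
    show "S - {x} \<subseteq> verts G" using sub by blast
    have separated: "nbhd G v \<inter> (S - {x}) \<noteq> nbhd G u \<inter> (S - {x})"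
      if u: "u \<in> verts G - (S - {x})" and v: "v \<in> verts G - S" and "u \<noteq> v" for u v
    proof
      assume eq: "nbhd G v \<inter> (S - {x}) = nbhd G u \<inter> (S - {x})"
      obtain a b where ab: "a \<in> S" "b \<in> S" "a \<noteq> b" "adj G v a" "adj G v b"
        using out v by blast
      \<comment> \<open>Otherwise \<open>a\<close> and \<open>b\<close> both survive the deletion of
        \<open>x\<close> and would be two common neighbours of \<open>u\<close> and
        \<open>v\<close>.\<close>
      have "x = a \<or> x = b"
        using ab common[of u v a b] adj_eq[OF eq] \<open>u \<noteq> v\<close> by blast
      then obtain b' where b': "b' \<in> S" "b' \<noteq> x" "adj G v x" "adj G v b'"
        using ab by blast
      then have ub': "adj G u b'"
        using adj_eq[OF eq] by blast
      show False
      \<comment> \<open>If \<open>u\<close> is the deleted vertex, then \<open>v\<close>,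
        \<open>x\<close>, \<open>b'\<close> form a triangle. Otherwise \<open>u\<close> lies outside
        \<open>S\<close> and has two neighbours in \<open>S\<close>: either both differ from
        \<open>x\<close> and are shared with \<open>v\<close>, or one is \<open>x\<close>, and then
        \<open>x\<close> and \<open>b'\<close> are both shared.\<close>
      proof (cases "u = x")
        case True
        then show False
          using tree_no_triangle[OF tree, of v x b'] b' ub' by blast
      next
        case False
        then obtain c d where cd: "c \<in> S" "d \<in> S" "c \<noteq> d" "adj G u c" "adj G u d"
          using out[of u] u by blast
        then show False
          using cd common[of u v c d] common[of u v x b'] adj_eq[OF eq] \<open>u \<noteq> v\<close> b' ub' by blast
      qed
    qed
    fix u v assume u: "u \<in> verts G - (S - {x})" and v: "v \<in> verts G - (S - {x})"
    show "nbhd G v \<inter> (S - {x}) \<noteq> {}"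
    proof (cases "v = x")
      case True
      then show ?thesis
        using ins[OF x] noloop in_nbhd_iff[OF tree] by blast
    next
      case False
      then show ?thesis
        using out[of v] v in_nbhd_iff[OF tree] by blast
    qed
    assume "u \<noteq> v"
    \<comment> \<open>Distinct \<open>u\<close> and \<open>v\<close> cannot both be
      \<open>x\<close>, so \<open>separated\<close> applies in at least one order.\<close>
    then show "nbhd G v \<inter> (S - {x}) \<noteq> nbhd G u \<inter> (S - {x})"
      using separated[of u v] separated[of v u] u v by blast
  qed
  ultimately show ?thesis by (simp add: red_ld_set_def)
qed

section \<open>Branches at a vertex\<close>

text \<open>A variant of \<open>attach\<close> in which a branch is indexed by the vertex that is
  joined to \<open>w\<close>. The degree of \<open>w\<close> becomes the size of \<open>X\<close>,
  and counts over branches become sums over \<open>X\<close>.\<close>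

definition join :: "'a \<Rightarrow> 'a set \<Rightarrow> ('a \<Rightarrow> 'a graph) \<Rightarrow> 'a graph" where
  "join w X T = \<lparr>verts = insert w (\<Union>x\<in>X. verts (T x)),
     edges = (\<Union>x\<in>X. edges (T x)) \<union> {{w, x} | x. x \<in> X}\<rparr>"

lemma join_image: "join w X T = \<lparr>verts = insert w (\<Union>x\<in>X. verts (T x)),
    edges = (\<Union>x\<in>X. edges (T x)) \<union> (\<lambda>x. {w, x}) ` X\<rparr>"
  by (auto simp: join_def)

lemma attach_map_eq_join: "attach w (map T xs) xs = join w (set xs) T"
  by (simp add: attach_def join_def)

text \<open>One set of conditions serves both for composing trees and for taking them apart.
  Disjointness is phrased so that a vertex determines the index of its branch.\<close>

locale tree_branches =
  fixes w :: 'a and X :: "'a set" and T :: "'a \<Rightarrow> 'a graph"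
  assumes finite_X: "finite X"
    and tree_T: "x \<in> X \<Longrightarrow> tree (T x)"
    and root: "x \<in> X \<Longrightarrow> x \<in> verts (T x)"
    and fresh: "x \<in> X \<Longrightarrow> w \<notin> verts (T x)"
    and disjoint: "x \<in> X \<Longrightarrow> y \<in> X \<Longrightarrow> v \<in> verts (T x) \<Longrightarrow> v \<in> verts (T y) \<Longrightarrow> x = y"
begin

lemma verts_join: "verts (join w X T) = insert w (\<Union>x\<in>X. verts (T x))"
  by (simp add: join_def)

lemma edge_subset: "x \<in> X \<Longrightarrow> e \<in> edges (T x) \<Longrightarrow> e \<subseteq> verts (T x) \<and> card e = 2"
  using treeD(1)[OF tree_T] by (simp add: simple_graph_def)

lemma adj_join_root: "adj (join w X T) w v \<longleftrightarrow> v \<in> X"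
  using edge_subset fresh by (fastforce simp: adj_def join_def doubleton_eq_iff)

text \<open>An edge at \<open>u\<close> that misses \<open>w\<close> comes from some branch, and
  containing \<open>u\<close> identifies that branch as \<open>T x\<close>.\<close>

lemma adj_join_branch:
  assumes "x \<in> X" "u \<in> verts (T x)" "v \<noteq> w"
  shows "adj (join w X T) u v \<longleftrightarrow> adj (T x) u v"
proof
  assume "adj (join w X T) u v"
  moreover have "u \<noteq> w" using assms fresh by blast
  ultimately obtain y where "y \<in> X" "{u, v} \<in> edges (T y)"
    using assms(3) by (auto simp: adj_def join_def doubleton_eq_iff)
  then show "adj (T x) u v"
    using edge_subset[of y] disjoint[of x y u] assms by (auto simp: adj_def)
qed (use assms in \<open>auto simp: adj_def join_def\<close>)

lemma simple_join: "simple_graph (join w X T)"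
  unfolding simple_graph_def
proof (intro conjI ballI)
  show "finite (verts (join w X T))"
    using finite_X tree_T treeD(4) by (auto simp: verts_join)
  fix e assume "e \<in> edges (join w X T)"
  then consider x where "x \<in> X" "e \<in> edges (T x)" | x where "x \<in> X" "e = {w, x}"
    by (auto simp: join_def)
  then show "e \<subseteq> verts (join w X T)" "card e = 2"
    using edge_subset root fresh by (cases; fastforce simp: verts_join card_2_iff)+
qed

lemma connected_join: "connected_graph (join w X T)"
proof -
  let ?G = "join w X T"
  have "(adj ?G)\<^sup>*\<^sup>* w v" and "(adj ?G)\<^sup>*\<^sup>* v w" if v: "v \<in> verts ?G" for v
  proof -
    have "(adj ?G)\<^sup>*\<^sup>* w v \<and> (adj ?G)\<^sup>*\<^sup>* v w"
    proof (cases "v = w")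
      case False
      then obtain x where x: "x \<in> X" "v \<in> verts (T x)"
        using v by (auto simp: verts_join)
      have mono: "adj (T x) \<le> adj ?G"
        using x(1) by (auto simp: adj_def join_def)
      have "(adj (T x))\<^sup>*\<^sup>* x v" "(adj (T x))\<^sup>*\<^sup>* v x"
        using treeD(2)[OF tree_T[OF x(1)]] root x by (auto simp: connected_graph_def)
      then have "(adj ?G)\<^sup>*\<^sup>* x v" "(adj ?G)\<^sup>*\<^sup>* v x"
        using rtranclp_mono[OF mono] by auto
      moreover have "adj ?G w x" "adj ?G x w"
        using adj_join_root[of x] x(1) adj_commute[of ?G w x] by auto
      ultimately show ?thesis
        by (meson converse_rtranclp_into_rtranclp rtranclp.rtrancl_into_rtrancl)
    qed simp
    then show "(adj ?G)\<^sup>*\<^sup>* w v" "(adj ?G)\<^sup>*\<^sup>* v w" by auto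
  qed
  then show ?thesis
    unfolding connected_graph_def by (auto simp: verts_join intro: rtranclp_trans)
qed

lemma branch_closed:
  assumes "x \<in> X" "u \<in> verts (T x)" "adj (join w X T) u v" "v \<noteq> w"
  shows "v \<in> verts (T x)"
  using adj_join_branch[OF assms(1,2,4)] assms(3)
    simple_graph_adjD(2)[OF treeD(1)[OF tree_T[OF assms(1)]]] by blast

text \<open>A cycle through \<open>w\<close> would connect two roots without using \<open>w\<close>,
  though a branch can be left only through \<open>w\<close>. A cycle that misses \<open>w\<close>
  stays inside one branch and contradicts that this branch is a tree.\<close>

lemma acyclic_join: "\<not> is_cycle (join w X T) c"
proof
  let ?G = "join w X T"
  assume c: "is_cycle ?G c"
  show False
  proof (cases "w \<in> set c")
    case True
    then obtain x y where xy: "x \<noteq> y" "adj ?G w x" "adj ?G w y" "(adj_avoiding ?G w)\<^sup>*\<^sup>* x y"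
      using cycle_neighbours_connected[OF c] by blast
    then have X: "x \<in> X" "y \<in> X"
      using adj_join_root by auto
    have "y \<in> verts (T x)"
      using xy(4)
    proof (induction rule: rtranclp_induct)
      case base
      show ?case using root X by blast
    next
      case (step y z)
      then show ?case
        using branch_closed[OF X(1)] by (auto simp: adj_avoiding_def)
    qed
    then show False
      using disjoint[OF X, of y] root X xy(1) by blast
  next
    case False
    have len: "length c \<ge> 3" and dist: "distinct c"
      and step: "\<And>i. i < length c \<Longrightarrow> adj ?G (c ! i) (c ! (Suc i mod length c))"
      using c by (auto simp: is_cycle_def)
    have nw: "c ! i \<noteq> w" if "i < length c" for i
      using False that nth_mem by metis
    have "adj ?G (c ! 0) (c ! (Suc 0 mod length c))"
      using step[of 0] len by fastforce
    then have "c ! 0 \<in> verts ?G"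
      using simple_graph_adjD(1)[OF simple_join] by blast
    then obtain x where x: "x \<in> X" "c ! 0 \<in> verts (T x)"
      using nw[of 0] len by (fastforce simp: verts_join)
    have inT: "c ! i \<in> verts (T x)" if "i < length c" for i
      using that
    proof (induction i)
      case (Suc i)
      then show ?case
        using branch_closed[OF x(1), of "c ! i" "c ! Suc i"] step[of i] nw[of "Suc i"] by simp
    qed (use x in simp)
    have "adj (T x) (c ! i) (c ! (Suc i mod length c))" if i: "i < length c" for i
    proof -
      have "Suc i mod length c < length c"
        using i by (intro mod_less_divisor) linarith
      then show ?thesis
        using adj_join_branch[OF x(1) inT[OF i] nw] step[OF i] by blast
    qed
    then have "is_cycle (T x) c"
      using len dist by (simp add: is_cycle_def)
    then show False
      using treeD(3)[OF tree_T[OF x(1)]] by blast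
  qed
qed

lemma tree_join: "tree (join w X T)"
  using simple_join connected_join acyclic_join by (simp add: tree_def)

lemma card_subset_branches:
  assumes "S \<subseteq> (\<Union>x\<in>X. verts (T x))"
  shows "card S = (\<Sum>x\<in>X. card (S \<inter> verts (T x)))"
proof -
  have "S = (\<Union>x\<in>X. S \<inter> verts (T x))"
    using assms by blast
  also have "card \<dots> = (\<Sum>x\<in>X. card (S \<inter> verts (T x)))"
    using finite_X treeD(4)[OF tree_T] disjoint by (intro card_UN_disjoint) auto
  finally show ?thesis .
qed

lemma card_verts_join: "card (verts (join w X T)) = Suc (\<Sum>x\<in>X. card (verts (T x)))"
proof -
  have "finite (\<Union>x\<in>X. verts (T x))" "w \<notin> (\<Union>x\<in>X. verts (T x))"
    using finite_X treeD(4)[OF tree_T] fresh by auto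
  moreover have "(\<Union>x\<in>X. verts (T x)) \<inter> verts (T y) = verts (T y)" if "y \<in> X" for y
    using that by blast
  ultimately show ?thesis
    using card_subset_branches[OF order.refl] by (simp add: verts_join)
qed

text \<open>Since \<open>w\<close> is not in \<open>S\<close>, a branch vertex sees members of
  \<open>S\<close> only within its own branch, so its condition is local. The condition at
  \<open>w\<close> says that two roots lie in \<open>S\<close>.\<close>

lemma double_dominating_join_iff:
  assumes S: "S \<subseteq> (\<Union>x\<in>X. verts (T x))"
  shows "double_dominating (join w X T) S \<longleftrightarrow>
    (\<forall>x\<in>X. double_dominating (T x) (S \<inter> verts (T x))) \<and> (\<exists>a\<in>S \<inter> X. \<exists>b\<in>S \<inter> X. a \<noteq> b)"
    (is "?L \<longleftrightarrow> ?R")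
proof -
  let ?G = "join w X T"
  have w: "w \<notin> S" using S fresh by blast
  have adj: "a \<in> S \<and> adj ?G v a \<longleftrightarrow> a \<in> S \<inter> verts (T x) \<and> adj (T x) v a"
    if "x \<in> X" "v \<in> verts (T x)" for x v a
    using adj_join_branch[OF that] branch_closed[OF that] w by (cases "a = w") auto
  \<comment> \<open>\<open>P\<close> and \<open>Q\<close> are the requirements for vertices outside
    and inside \<open>S\<close>; membership in \<open>S\<close> is kept next to adjacency so that
    \<open>adj\<close> can rewrite both together.\<close>
  define P where "P v \<longleftrightarrow> (\<exists>a b. (a \<in> S \<and> adj ?G v a) \<and> (b \<in> S \<and> adj ?G v b) \<and> a \<noteq> b)" for v
  define Q where "Q v \<longleftrightarrow> (\<exists>a. a \<in> S \<and> adj ?G v a)" for v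
  have Pw: "P w \<longleftrightarrow> (\<exists>a\<in>S \<inter> X. \<exists>b\<in>S \<inter> X. a \<noteq> b)"
    unfolding P_def adj_join_root by blast
  have branch: "double_dominating (T x) (S \<inter> verts (T x)) \<longleftrightarrow>
      (\<forall>v\<in>verts (T x). (v \<notin> S \<longrightarrow> P v) \<and> (v \<in> S \<longrightarrow> Q v))" if x: "x \<in> X" for x
  proof -
    have "P v \<longleftrightarrow> (\<exists>a\<in>S \<inter> verts (T x). \<exists>b\<in>S \<inter> verts (T x). a \<noteq> b \<and> adj (T x) v a \<and> adj (T x) v b)"
      "Q v \<longleftrightarrow> (\<exists>a\<in>S \<inter> verts (T x). adj (T x) v a)" if "v \<in> verts (T x)" for v
      unfolding P_def Q_def adj[OF x that] by blast+
    then show ?thesis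
      unfolding double_dominating_def by auto
  qed
  have "?L \<longleftrightarrow> (\<forall>v\<in>verts ?G - S. P v) \<and> (\<forall>v\<in>S. Q v)"
    using S unfolding double_dominating_def verts_join P_def Q_def by blast
  also have "\<dots> \<longleftrightarrow> P w \<and> (\<forall>x\<in>X. \<forall>v\<in>verts (T x). (v \<notin> S \<longrightarrow> P v) \<and> (v \<in> S \<longrightarrow> Q v))"
    using S w unfolding verts_join by blast
  also have "\<dots> \<longleftrightarrow> ?R"
    unfolding Pw using branch by blast
  finally show ?thesis .
qed

end

text \<open>The branch at \<open>x\<close> is the component of \<open>x\<close> after removal of
  \<open>w\<close>. Separation of neighbours makes the branches disjoint, and connectedness of
  \<open>G\<close> makes them cover everything but \<open>w\<close>.\<close>

lemma tree_eq_join: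
  assumes tree: "tree G" and w: "w \<in> verts G"
  obtains T where "tree_branches w (nbhd G w) T" "G = join w (nbhd G w) T"
proof -
  note simple = simple_graph_adjD[OF treeD(1)[OF tree]]
  define C where "C x = {v. (adj_avoiding G w)\<^sup>*\<^sup>* x v}" for x
  define T where "T x = \<lparr>verts = C x, edges = {e \<in> edges G. e \<subseteq> C x}\<rparr>" for x
  have adj_T: "adj (T x) u v \<longleftrightarrow> adj G u v \<and> u \<in> C x \<and> v \<in> C x" for x u v
    by (auto simp: adj_def T_def)
  have x: "adj G w x" "x \<noteq> w" "x \<in> verts G" if "x \<in> nbhd G w" for x
    using that simple[of w x] by (auto simp: nbhd_def)
  have C: "v \<in> verts G \<and> v \<noteq> w" if "x \<in> nbhd G w" "v \<in> C x" for x v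
  proof -
    have "(adj_avoiding G w)\<^sup>*\<^sup>* x v"
      using that(2) by (simp add: C_def)
    then show ?thesis
      by (induction rule: rtranclp_induct) (use x[OF that(1)] simple in \<open>auto simp: adj_avoiding_def\<close>)
  qed
  have closed: "v \<in> C x" if "x \<in> nbhd G w" "u \<in> C x" "adj G u v" "v \<noteq> w" for x u v
  proof -
    have "adj_avoiding G w u v"
      using that C by (auto simp: adj_avoiding_def)
    then show ?thesis
      using that(2) by (auto simp: C_def intro: rtranclp.rtrancl_into_rtrancl)
  qed
  have tree_T: "tree (T x)" if X: "x \<in> nbhd G w" for x
  proof -
    have "simple_graph (T x)"
      using C[OF X] treeD(1)[OF tree] finite_subset[of "C x" "verts G"]
      by (auto simp: simple_graph_def T_def)
    moreover have "connected_graph (T x)"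
    proof -
      have path: "(adj (T x))\<^sup>*\<^sup>* x v \<and> (adj (T x))\<^sup>*\<^sup>* v x" if "v \<in> C x" for v
      proof -
        have "(adj_avoiding G w)\<^sup>*\<^sup>* x v"
          using that by (simp add: C_def)
        then show ?thesis
        proof (induction rule: rtranclp_induct)
          case (step y z)
          then have "y \<in> C x" "z \<in> C x"
            by (auto simp: C_def intro: rtranclp.rtrancl_into_rtrancl)
          then have "adj (T x) y z" "adj (T x) z y"
            using step by (auto simp: adj_T adj_avoiding_def adj_commute)
          then show ?case
            using step.IH by (meson converse_rtranclp_into_rtranclp rtranclp.rtrancl_into_rtrancl)
        qed simp
      qed
      have "(adj (T x))\<^sup>*\<^sup>* u v" if "u \<in> C x" "v \<in> C x" for u v
        using path[OF that(1)] path[OF that(2)] by (meson rtranclp_trans)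
      moreover have "x \<in> C x" by (simp add: C_def)
      ultimately show ?thesis
        by (auto simp: connected_graph_def T_def)
    qed
    moreover have "\<not> is_cycle (T x) c" for c
      using treeD(3)[OF tree, of c] by (auto simp: is_cycle_def adj_T)
    ultimately show ?thesis by (simp add: tree_def)
  qed
  have branches: "tree_branches w (nbhd G w) T"
  proof
    show "finite (nbhd G w)"
      using treeD(4)[OF tree] by (simp add: nbhd_def)
    fix x y v
    assume X: "x \<in> nbhd G w"
    show "tree (T x)" using tree_T X .
    show "x \<in> verts (T x)" by (simp add: T_def C_def)
    show "w \<notin> verts (T x)" using C[OF X] by (auto simp: T_def)
    assume "y \<in> nbhd G w" "v \<in> verts (T x)" "v \<in> verts (T y)"
    then have "(adj_avoiding G w)\<^sup>*\<^sup>* x v" "(adj_avoiding G w)\<^sup>*\<^sup>* v y"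
      using adj_avoiding_rtranclp_commute by (auto simp: T_def C_def)
    then have "(adj_avoiding G w)\<^sup>*\<^sup>* x y"
      by (rule rtranclp_trans)
    then show "x = y"
      using tree_neighbours_separated[OF tree] x X \<open>y \<in> nbhd G w\<close> by blast
  qed
  have cover: "\<exists>x\<in>nbhd G w. v \<in> C x" if "v \<in> verts G" "v \<noteq> w" for v
  proof -
    have "(adj G)\<^sup>*\<^sup>* w v"
      using treeD(2)[OF tree] w that(1) by (auto simp: connected_graph_def)
    \<comment> \<open>Along a walk from \<open>w\<close>, every step out of \<open>w\<close> enters
      the branch of the next vertex, and every other step stays in its branch or returns to
      \<open>w\<close>.\<close>
    then have "v = w \<or> (\<exists>x\<in>nbhd G w. v \<in> C x)"
    proof (induction rule: rtranclp_induct)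
      case (step y z)
      show ?case
      proof (cases "y = w")
        case True
        then have "z \<in> nbhd G w" "z \<in> C z"
          using step in_nbhd_iff[OF tree] by (auto simp: C_def)
        then show ?thesis by blast
      next
        case False
        then show ?thesis using step closed by blast
      qed
    qed simp
    then show ?thesis using that(2) by blast
  qed
  have "verts G = verts (join w (nbhd G w) T)"
    using C cover w by (auto simp: join_def T_def)
  moreover have "edges G = edges (join w (nbhd G w) T)"
  proof (intro equalityI subsetI)
    fix e assume e: "e \<in> edges G"
    then obtain u v where uv: "e = {u, v}"
      using treeD(1)[OF tree] by (auto simp: simple_graph_def card_2_iff)
    then have adj: "adj G u v" "adj G v u"
      using e by (auto simp: adj_def insert_commute)
    consider "u = w" | "v = w" | "u \<noteq> w" "v \<noteq> w" by blast
    then show "e \<in> edges (join w (nbhd G w) T)"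
    proof cases
      case 3
      then obtain x where X: "x \<in> nbhd G w" "u \<in> C x"
        using cover simple(1)[OF adj(1)] by blast
      then have "e \<in> edges (T x)"
        using closed[OF X adj(1)] 3 e uv by (auto simp: T_def)
      then show ?thesis using X(1) by (auto simp: join_def)
    qed (use adj uv in_nbhd_iff[OF tree] in \<open>auto simp: join_def insert_commute\<close>)
  next
    fix e assume "e \<in> edges (join w (nbhd G w) T)"
    then show "e \<in> edges G"
      using in_nbhd_iff[OF tree] by (auto simp: join_def T_def adj_def)
  qed
  ultimately have "G = join w (nbhd G w) T" by simp
  then show thesis using that branches by blast
qed

section \<open>The lower bound and extremal trees\<close>

lemma double_dominating_card_verts:
  assumes "tree G" "double_dominating G S"
  shows "card (verts G) \<ge> 2"
proof -
  obtain v where v: "v \<in> verts G"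
    using treeD(5)[OF assms(1)] by blast
  then obtain a where "adj G v a"
    using assms(2) by (fastforce simp: double_dominating_def)
  then have "{v, a} \<subseteq> verts G" "v \<noteq> a"
    using simple_graph_adjD[OF treeD(1)[OF assms(1)]] by auto
  then show ?thesis
    using card_mono[OF treeD(4)[OF assms(1)], of "{v, a}"] by simp
qed

text \<open>The common form of the induction step for the lower bound and for the decomposition:
  \<open>a\<close> and \<open>b\<close> are two neighbours of \<open>w\<close> in \<open>S\<close>,
  hence roots of different branches.\<close>

lemma double_dominating_split:
  assumes "tree G" "double_dominating G S" "w \<in> verts G" "w \<notin> S"
  obtains X T a b where "tree_branches w X T" "G = join w X T" "S \<subseteq> (\<Union>x\<in>X. verts (T x))"
    "\<And>x. x \<in> X \<Longrightarrow> double_dominating (T x) (S \<inter> verts (T x))"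
    "a \<in> S" "a \<in> X" "b \<in> S" "b \<in> X" "a \<noteq> b"
proof -
  obtain T where T: "tree_branches w (nbhd G w) T" "G = join w (nbhd G w) T"
    using tree_eq_join[OF assms(1,3)] .
  interpret tree_branches w "nbhd G w" T by (fact T(1))
  have sub: "S \<subseteq> (\<Union>x\<in>nbhd G w. verts (T x))"
    using assms(2,4) T(2) verts_join by (auto simp: double_dominating_def)
  have "double_dominating (join w (nbhd G w) T) S"
    using assms(2) T(2) by simp
  then show thesis
    using that[OF T sub] unfolding double_dominating_join_iff[OF sub] by blast
qed

text \<open>Summing over d branches gives 2(n - 1) + 2d \<le> 3|S|, and d \<ge> 2 is just enough to
  recover the constant 2. If \<open>S\<close> is everything, the claim is n \<ge> 2.\<close>

lemma double_dominating_lower_bound: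
  assumes "tree G" "double_dominating G S"
  shows "2 * card (verts G) + 2 \<le> 3 * card S"
  using assms
proof (induction "card (verts G)" arbitrary: G S rule: less_induct)
  case less
  show ?case
  proof (cases "verts G \<subseteq> S")
    case True
    then have "S = verts G"
      using less.prems by (auto simp: double_dominating_def)
    then show ?thesis
      using double_dominating_card_verts[OF less.prems] by simp
  next
    case False
    then obtain w where "w \<in> verts G" "w \<notin> S" by blast
    from double_dominating_split[OF less.prems this]
    obtain X T a b where T: "tree_branches w X T" "G = join w X T" "S \<subseteq> (\<Union>x\<in>X. verts (T x))"
      and dd: "\<And>x. x \<in> X \<Longrightarrow> double_dominating (T x) (S \<inter> verts (T x))"
      and ab: "a \<in> X" "b \<in> X" "a \<noteq> b"
      by metis
    interpret tree_branches w X T by (fact T(1))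
    have n: "card (verts G) = Suc (\<Sum>x\<in>X. card (verts (T x)))"
      using card_verts_join T(2) by simp
    have "2 * card (verts (T x)) + 2 \<le> 3 * card (S \<inter> verts (T x))" if "x \<in> X" for x
    proof (rule less.hyps[OF _ tree_T[OF that] dd[OF that]])
      show "card (verts (T x)) < card (verts G)"
        unfolding n using member_le_sum[OF that, of "\<lambda>x. card (verts (T x))"] finite_X by simp
    qed
    then have "(\<Sum>x\<in>X. 2 * card (verts (T x)) + 2) \<le> (\<Sum>x\<in>X. 3 * card (S \<inter> verts (T x)))"
      by (rule sum_mono)
    then have "2 * (\<Sum>x\<in>X. card (verts (T x))) + 2 * card X \<le> 3 * card S"
      unfolding card_subset_branches[OF T(3)] by (simp only: sum.distrib sum_distrib_left) simp
    moreover have "2 \<le> card X"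
      using card_mono[OF finite_X, of "{a, b}"] ab by simp
    ultimately show ?thesis using n by simp
  qed
qed

lemma tree_verts_double_dominating:
  assumes "tree G" "card (verts G) \<ge> 2"
  shows "double_dominating G (verts G)"
proof -
  have "\<exists>a\<in>verts G. adj G v a" if v: "v \<in> verts G" for v
  proof -
    have "\<not> verts G \<subseteq> {v}"
      using assms(2) card_mono[of "{v}" "verts G"] by auto
    then obtain u where u: "u \<in> verts G" "u \<noteq> v" by blast
    then have "(adj G)\<^sup>*\<^sup>* v u"
      using treeD(2)[OF assms(1)] v by (auto simp: connected_graph_def)
    then obtain a where "adj G v a"
      using u(2) by (auto elim: converse_rtranclpE)
    then show ?thesis
      using simple_graph_adjD(2)[OF treeD(1)[OF assms(1)]] by blast
  qed
  then show ?thesis by (simp add: double_dominating_def)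
qed

text \<open>Clearing the denominator gives 2n + 2 \<le> 3k < 2n + 5; integrality turns the strict
  bound into the constant 4.\<close>

lemma ceiling_bound_iff:
  "int k = \<lceil>(2 * real n + 2) / 3\<rceil> \<longleftrightarrow> 2 * n + 2 \<le> 3 * k \<and> 3 * k \<le> 2 * n + 4"
proof -
  have "int k = \<lceil>(2 * real n + 2) / 3\<rceil> \<longleftrightarrow>
      real k - 1 < (2 * real n + 2) / 3 \<and> (2 * real n + 2) / 3 \<le> real k"
    by (auto simp: eq_commute[of "int k"] ceiling_eq_iff)
  also have "\<dots> \<longleftrightarrow> real (3 * k) < real (2 * n + 5) \<and> real (2 * n + 2) \<le> real (3 * k)"
    by (simp add: field_simps)
  finally show ?thesis
    unfolding of_nat_less_iff of_nat_le_iff by linarith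
qed

text \<open>Combined with the lower bound, 3|S| \<le> 2n + 4 says that |S| equals the ceiling of
  (2n + 2)/3.\<close>

lemma double_dominating_min:
  assumes "tree T" "double_dominating T S" "3 * card S \<le> 2 * card (verts T) + 4"
  shows "min_red_ld_set T S" "T \<in> T_min"
proof -
  have le: "card S \<le> card S'" if "red_ld_set T S'" for S'
    using double_dominating_lower_bound[OF assms(1) red_ld_imp_double_dominating[OF that]] assms(3)
    by simp
  have red: "red_ld_set T S"
    using double_dominating_imp_red_ld assms by blast
  then show "min_red_ld_set T S"
    using le by (simp add: min_red_ld_set_def)
  have "RED_LD T = card S"
    unfolding RED_LD_def using red le by (intro Least_equality) auto
  then show "T \<in> T_min"
    using assms double_dominating_card_verts[OF assms(1,2)]
      double_dominating_lower_bound[OF assms(1,2)]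
    by (simp add: T_min_def ceiling_bound_iff)
qed

lemma T_min_obtain:
  assumes "T \<in> T_min"
  obtains S where "double_dominating T S" "3 * card S \<le> 2 * card (verts T) + 4"
proof -
  have T: "tree T" "card (verts T) \<ge> 2" "3 * RED_LD T \<le> 2 * card (verts T) + 4"
    using assms by (auto simp: T_min_def ceiling_bound_iff)
  have "\<exists>S. red_ld_set T S \<and> card S = RED_LD T"
    unfolding RED_LD_def
    \<comment> \<open>The whole vertex set witnesses that the minimum in \<open>RED_LD\<close> is
      attained.\<close>
    by (rule LeastI[of _ "card (verts T)"])
      (use double_dominating_imp_red_ld[OF T(1) tree_verts_double_dominating[OF T(1,2)]] in blast)
  then show thesis
    using that T(3) red_ld_imp_double_dominating by metis
qed

text \<open>The operations admit an arbitrary minimum set of each part, so the bound has to hold for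
  every such set; comparison with one good set transfers it.\<close>

lemma T_min_min_red_ld_setD:
  assumes "T \<in> T_min" "min_red_ld_set T S"
  shows "double_dominating T S" "3 * card S \<le> 2 * card (verts T) + 4"
    "2 * card (verts T) + 2 \<le> 3 * card S"
proof -
  have tree: "tree T" using assms(1) by (simp add: T_min_def)
  show dd: "double_dominating T S"
    using assms(2) red_ld_imp_double_dominating by (auto simp: min_red_ld_set_def)
  obtain S' where S': "double_dominating T S'" "3 * card S' \<le> 2 * card (verts T) + 4"
    using T_min_obtain[OF assms(1)] .
  then have "card S \<le> card S'"
    using assms(2) double_dominating_imp_red_ld[OF tree] by (auto simp: min_red_ld_set_def)
  then show "3 * card S \<le> 2 * card (verts T) + 4"
    using S'(2) by simp
  show "2 * card (verts T) + 2 \<le> 3 * card S"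
    using double_dominating_lower_bound[OF tree dd] .
qed

text \<open>The union of the chosen sets is a witness: \<open>a\<close> and \<open>b\<close>
  dominate \<open>w\<close> twice, and the residues keep the size within the bound.\<close>

lemma attach_in_T_min:
  assumes branches: "tree_branches w (set xs) T" and dist: "distinct xs"
    and S: "\<And>x. x \<in> set xs \<Longrightarrow> T x \<in> T_min \<and> min_red_ld_set (T x) (S x)"
    and sizes: "map (\<lambda>x. card (verts (T x)) mod 3) xs \<in> {[2, 2], [0, 2], [0, 0], [1, 2], [2, 2, 2]}"
    and ab: "a \<in> set xs" "b \<in> set xs" "a \<noteq> b" "a \<in> S a" "b \<in> S b"
  shows "attach w (map T xs) xs \<in> T_min"
proof -
  interpret tree_branches w "set xs" T by (fact branches)
  let ?S = "\<Union>x\<in>set xs. S x"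
  note D = T_min_min_red_ld_setD[OF conjunct1[OF S] conjunct2[OF S]]
  have Sx: "S x \<subseteq> verts (T x)" if "x \<in> set xs" for x
    using D(1)[OF that that] by (simp add: double_dominating_def)
  then have sub: "?S \<subseteq> (\<Union>x\<in>set xs. verts (T x))" by blast
  have restrict: "?S \<inter> verts (T x) = S x" if "x \<in> set xs" for x
    using that Sx disjoint by blast
  have "double_dominating (join w (set xs) T) ?S"
    unfolding double_dominating_join_iff[OF sub] using D(1) ab by (auto simp: restrict)
  moreover have "3 * card ?S \<le> 2 * card (verts (join w (set xs) T)) + 4"
  proof -
    have card: "card ?S = (\<Sum>x\<leftarrow>xs. card (S x))"
      using card_subset_branches[OF sub] dist by (simp add: restrict sum_list_distinct_conv_sum_set)
    have n: "card (verts (join w (set xs) T)) = Suc (\<Sum>x\<leftarrow>xs. card (verts (T x)))"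
      using card_verts_join dist by (simp add: sum_list_distinct_conv_sum_set)
    have bound: "\<And>x. x \<in> set xs \<Longrightarrow> 3 * card (S x) \<le> 2 * card (verts (T x)) + 4"
      using D(2) by blast
    \<comment> \<open>3s - 2m is congruent to m modulo 3, so the slack 4 drops to 2 for residue 2
      and to 3 for residue 0. The new vertex leaves room for a total of 6, and each of the five
      patterns respects it.\<close>
    have mod: "3 * s \<le> 2 * m + 2" if "3 * s \<le> 2 * m + 4" "m mod 3 = 2" for s m :: nat
      using that by presburger
    have mod': "3 * s \<le> 2 * m + 3" if "3 * s \<le> 2 * m + 4" "m mod 3 = 0" for s m :: nat
      using that by presburger
    consider x y where "xs = [x, y]" | x y z where "xs = [x, y, z]"
      using sizes by auto
    then show ?thesis
    proof cases
      case 1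
      then show ?thesis
        using sizes bound[of x] bound[of y] mod[OF bound[of x]] mod[OF bound[of y]] mod'[OF bound[of x]] mod'[OF bound[of y]]
        unfolding card n by auto
    next
      case 2
      then show ?thesis
        using sizes mod[OF bound[of x]] mod[OF bound[of y]] mod[OF bound[of z]]
        unfolding card n by auto
    qed
  qed
  ultimately show ?thesis
    unfolding attach_map_eq_join using double_dominating_min(2) tree_join by blast
qed

lemma tree_branches_pair:
  assumes "tree T1" "tree T2" "w1 \<in> verts T1" "w2 \<in> verts T2"
    "verts T1 \<inter> verts T2 = {}" "w \<notin> verts T1 \<union> verts T2"
  shows "tree_branches w {w1, w2} (\<lambda>x. if x = w1 then T1 else T2)"
  using assms by unfold_locales (auto split: if_splits)

lemma attach_pair_in_T_min:
  assumes T: "T1 \<in> T_min" "T2 \<in> T_min" "verts T1 \<inter> verts T2 = {}" "w \<notin> verts T1 \<union> verts T2"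
    and S: "min_red_ld_set T1 S1" "min_red_ld_set T2 S2"
    and sizes: "card (verts T1) mod 3 \<in> {0, 2}" "card (verts T2) mod 3 = 2"
    and w: "w1 \<in> S1" "w2 \<in> S2"
  shows "attach w [T1, T2] [w1, w2] \<in> T_min"
proof -
  have v: "w1 \<in> verts T1" "w2 \<in> verts T2"
    using T_min_min_red_ld_setD(1)[OF T(1) S(1)] T_min_min_red_ld_setD(1)[OF T(2) S(2)] w
    by (auto simp: double_dominating_def)
  then have ne: "w1 \<noteq> w2" using T(3) by blast
  let ?T = "\<lambda>x. if x = w1 then T1 else T2" and ?S = "\<lambda>x. if x = w1 then S1 else S2"
  have "tree_branches w {w1, w2} ?T"
    using v T by (intro tree_branches_pair) (auto simp: T_min_def)
  then have "attach w (map ?T [w1, w2]) [w1, w2] \<in> T_min"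
    using ne T S sizes w by (intro attach_in_T_min[where S = ?S and a = w1 and b = w2]) auto
  then show ?thesis using ne by simp
qed

text \<open>A bridge from the lists of \<open>op_c\<close>, matched by position, to branches indexed
  by their roots.\<close>

lemma map_of_distinct:
  assumes "distinct xs" "length ys = length xs"
  obtains f where "ys = map f xs"
proof -
  have "ys = map (the \<circ> map_of (zip xs ys)) xs"
    using assms by (intro nth_equalityI) (auto simp: map_of_zip_nth)
  then show thesis using that by blast
qed

lemma attach_list_in_T_min:
  assumes len: "length Ss = length Ts" "length xs = length Ts"
    and T: "\<forall>i<length Ts. Ts ! i \<in> T_min \<and> min_red_ld_set (Ts ! i) (Ss ! i) \<and> xs ! i \<in> verts (Ts ! i)"
    and disj: "\<forall>i<length Ts. \<forall>j<length Ts. i \<noteq> j \<longrightarrow> verts (Ts ! i) \<inter> verts (Ts ! j) = {}"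
    and fresh: "\<forall>i<length Ts. w \<notin> verts (Ts ! i)"
    and sizes: "map (\<lambda>T. card (verts T) mod 3) Ts \<in> {[0, 0], [1, 2], [2, 2, 2]}"
    and card: "card (nbhd (attach w Ts xs) w \<inter> (\<Union>S\<in>set Ss. S)) \<ge> 2"
  shows "attach w Ts xs \<in> T_min"
proof -
  have dist: "distinct xs"
    unfolding distinct_conv_nth using T disj len by (metis disjoint_iff)
  obtain T' where T': "Ts = map T' xs"
    using map_of_distinct[OF dist] len by metis
  obtain S' where S': "Ss = map S' xs"
    using map_of_distinct[OF dist] len by metis
  have T2: "T' x \<in> T_min \<and> min_red_ld_set (T' x) (S' x)" "x \<in> verts (T' x)" "w \<notin> verts (T' x)"
    if "x \<in> set xs" for x
    using T fresh that by (auto simp: T' S' in_set_conv_nth)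
  have disj': "x = y" if "x \<in> set xs" "y \<in> set xs" "v \<in> verts (T' x)" "v \<in> verts (T' y)" for x y v
    using disj that by (fastforce simp: T' in_set_conv_nth)
  have branches: "tree_branches w (set xs) T'"
    using T2 disj' by unfold_locales (auto simp: T_min_def)
  then interpret tree_branches w "set xs" T' .
  let ?A = "nbhd (attach w Ts xs) w \<inter> (\<Union>S\<in>set Ss. S)"
  \<comment> \<open>A neighbour of \<open>w\<close> is a root. If it lies in the set chosen for some
    branch, disjointness forces that branch to be its own.\<close>
  have A: "a \<in> set xs \<and> a \<in> S' a" if a_in: "a \<in> ?A" for a
  proof -
    have a: "a \<in> set xs"
      using that adj_join_root by (auto simp: T' attach_map_eq_join nbhd_def)
    obtain x where x: "x \<in> set xs" "a \<in> S' x"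
      using a_in by (auto simp: S')
    then have "a \<in> verts (T' x)"
      using T_min_min_red_ld_setD(1)[of "T' x" "S' x"] T2(1)[OF x(1)]
      by (auto simp: double_dominating_def)
    then show ?thesis
      using disj'[OF x(1) a] T2(2)[OF a] x a by blast
  qed
  have "\<not> card ?A \<le> Suc 0" and "finite ?A"
    using card by (simp, intro card_ge_0_finite) linarith
  then obtain a b where ab: "a \<in> ?A" "b \<in> ?A" "a \<noteq> b"
    unfolding card_le_Suc0_iff_eq[OF \<open>finite ?A\<close>] by metis
  have sizes': "map (\<lambda>x. card (verts (T' x)) mod 3) xs \<in> {[2, 2], [0, 2], [0, 0], [1, 2], [2, 2, 2]}"
    using sizes unfolding T' map_map comp_def by blast
  show ?thesis
    unfolding T'
    by (rule attach_in_T_min[OF branches dist T2(1) sizes', of a b])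
      (use A[OF ab(1)] A[OF ab(2)] ab(3) in auto)
qed

section \<open>Trees of order at most four\<close>

lemma tree_branches_leaf:
  assumes "tree G" "x \<in> verts G" "w \<notin> verts G"
  shows "tree_branches w {x} (\<lambda>_. G)"
  using assms by unfold_locales auto

lemma join_singleton: "join w {x} T = \<lparr>verts = insert w (verts (T x)), edges = insert {w, x} (edges (T x))\<rparr>"
  by (simp add: join_image)

lemma tree_add_leaf:
  assumes "tree G" "x \<in> verts G" "w \<notin> verts G"
  shows "tree \<lparr>verts = insert w (verts G), edges = insert {w, x} (edges G)\<rparr>"
  using tree_branches.tree_join[OF tree_branches_leaf[OF assms]] by (simp add: join_singleton)

lemma tree_K1: "tree \<lparr>verts = {a}, edges = {}\<rparr>"
proof -
  have "\<not> is_cycle \<lparr>verts = {a}, edges = {}\<rparr> c" for c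
    by (cases c) (auto simp: is_cycle_def adj_def)
  then show ?thesis
    by (simp add: tree_def simple_graph_def connected_graph_def)
qed

lemma tree_P2: "a \<noteq> b \<Longrightarrow> tree \<lparr>verts = {a, b}, edges = {{a, b}}\<rparr>"
  using tree_add_leaf[OF tree_K1, of b b a] by simp

lemma tree_P3: "distinct [a, b, c] \<Longrightarrow> tree \<lparr>verts = {a, b, c}, edges = {{a, b}, {b, c}}\<rparr>"
  using tree_add_leaf[OF tree_P2[of b c], of b a] by simp

lemma tree_P4:
  "distinct [a, b, c, d] \<Longrightarrow> tree \<lparr>verts = {a, b, c, d}, edges = {{a, b}, {b, c}, {c, d}}\<rparr>"
  using tree_add_leaf[OF tree_P3[of b c d], of b a] by simp

lemma tree_K13:
  "distinct [a, b, c, d] \<Longrightarrow> tree \<lparr>verts = {a, b, c, d}, edges = {{a, b}, {a, c}, {a, d}}\<rparr>"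
  using tree_add_leaf[OF tree_P3[of c a d], of a b] by (auto simp: insert_commute)

section \<open>Explicit forms of the labelled copies of the base trees\<close>

lemma edges_path_graph:
  "edges (path_graph 2) = {{0, 1}}"
  "edges (path_graph 3) = {{0, 1}, {1, 2}}"
  "edges (path_graph 4) = {{0, 1}, {1, 2}, {2, 3}}"
proof -
  have "edges (path_graph k) = (\<lambda>i. {i, Suc i}) ` {..<k - 1}" for k
    by (auto simp: path_graph_def)
  then show "edges (path_graph 2) = {{0, 1}}" "edges (path_graph 3) = {{0, 1}, {1, 2}}"
    "edges (path_graph 4) = {{0, 1}, {1, 2}, {2, 3}}"
    by (simp_all add: eval_nat_numeral lessThan_Suc insert_commute)
qed

lemma edges_star_graph: "edges (star_graph 3) = {{0, 1}, {0, 2}, {0, 3}}"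
proof -
  have "edges (star_graph 3) = (\<lambda>i. {0, i}) ` {1..3}"
    by (auto simp: star_graph_def)
  also have "{1..3} = {1, 2, 3 :: nat}" by auto
  finally show ?thesis by simp
qed

lemma verts_small_graphs:
  "verts (path_graph 2) = {0, 1}"
  "verts (path_graph 3) = {0, 1, 2}"
  "verts (path_graph 4) = {0, 1, 2, 3}"
  "verts (star_graph 3) = {0, 1, 2, 3}"
  by (auto simp: path_graph_def star_graph_def)

lemma graph_iso_P2_iff:
  "graph_iso (path_graph 2) G \<longleftrightarrow> (\<exists>a b. a \<noteq> b \<and> G = \<lparr>verts = {a, b}, edges = {{a, b}}\<rparr>)"
proof
  assume "graph_iso (path_graph 2) G"
  then obtain f :: "nat \<Rightarrow> 'a" where "bij_betw f {0, 1} (verts G)" "edges G = (`) f ` {{0, 1}}"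
    unfolding graph_iso_def edges_path_graph verts_small_graphs by blast
  then have "f 0 \<noteq> f 1" "G = \<lparr>verts = {f 0, f 1}, edges = {{f 0, f 1}}\<rparr>"
    by (auto simp: bij_betw_def)
  then show "\<exists>a b. a \<noteq> b \<and> G = \<lparr>verts = {a, b}, edges = {{a, b}}\<rparr>" by blast
next
  assume "\<exists>a b. a \<noteq> b \<and> G = \<lparr>verts = {a, b}, edges = {{a, b}}\<rparr>"
  then obtain a b where ab: "a \<noteq> b" "G = \<lparr>verts = {a, b}, edges = {{a, b}}\<rparr>" by blast
  show "graph_iso (path_graph 2) G"
    unfolding graph_iso_def edges_path_graph verts_small_graphs
    \<comment> \<open>List indexing is the isomorphism; only its values on the vertices of the path
      matter.\<close>
    by (rule exI[of _ "\<lambda>i. [a, b] ! i"]) (use ab in \<open>auto simp: bij_betw_def\<close>)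
qed

lemma graph_iso_P3_iff:
  "graph_iso (path_graph 3) G \<longleftrightarrow>
    (\<exists>a b c. distinct [a, b, c] \<and> G = \<lparr>verts = {a, b, c}, edges = {{a, b}, {b, c}}\<rparr>)" (is "_ \<longleftrightarrow> ?R")
proof
  assume "graph_iso (path_graph 3) G"
  then obtain f :: "nat \<Rightarrow> 'a" where "bij_betw f {0, 1, 2} (verts G)" "edges G = (`) f ` {{0, 1}, {1, 2}}"
    unfolding graph_iso_def edges_path_graph verts_small_graphs by blast
  then have "distinct [f 0, f 1, f 2]"
    "G = \<lparr>verts = {f 0, f 1, f 2}, edges = {{f 0, f 1}, {f 1, f 2}}\<rparr>"
    by (auto simp: bij_betw_def)
  then show ?R by blast
next
  assume ?R
  then obtain a b c where abc: "distinct [a, b, c]"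
    "G = \<lparr>verts = {a, b, c}, edges = {{a, b}, {b, c}}\<rparr>" by blast
  show "graph_iso (path_graph 3) G"
    unfolding graph_iso_def edges_path_graph verts_small_graphs
    by (rule exI[of _ "\<lambda>i. [a, b, c] ! i"]) (use abc in \<open>auto simp: bij_betw_def\<close>)
qed

lemma graph_iso_P4_iff:
  "graph_iso (path_graph 4) G \<longleftrightarrow> (\<exists>a b c d. distinct [a, b, c, d] \<and>
    G = \<lparr>verts = {a, b, c, d}, edges = {{a, b}, {b, c}, {c, d}}\<rparr>)" (is "_ \<longleftrightarrow> ?R")
proof
  assume "graph_iso (path_graph 4) G"
  then obtain f :: "nat \<Rightarrow> 'a" where "bij_betw f {0, 1, 2, 3} (verts G)"
    "edges G = (`) f ` {{0, 1}, {1, 2}, {2, 3}}"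
    unfolding graph_iso_def edges_path_graph verts_small_graphs by blast
  then have "distinct [f 0, f 1, f 2, f 3]"
    "G = \<lparr>verts = {f 0, f 1, f 2, f 3}, edges = {{f 0, f 1}, {f 1, f 2}, {f 2, f 3}}\<rparr>"
    by (auto simp: bij_betw_def)
  then show ?R by blast
next
  assume ?R
  then obtain a b c d where abcd: "distinct [a, b, c, d]"
    "G = \<lparr>verts = {a, b, c, d}, edges = {{a, b}, {b, c}, {c, d}}\<rparr>" by blast
  show "graph_iso (path_graph 4) G"
    unfolding graph_iso_def edges_path_graph verts_small_graphs
    by (rule exI[of _ "\<lambda>i. [a, b, c, d] ! i"]) (use abcd in \<open>auto simp: bij_betw_def\<close>)
qed

lemma graph_iso_K13_iff:
  "graph_iso (star_graph 3) G \<longleftrightarrow> (\<exists>a b c d. distinct [a, b, c, d] \<and>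
    G = \<lparr>verts = {a, b, c, d}, edges = {{a, b}, {a, c}, {a, d}}\<rparr>)" (is "_ \<longleftrightarrow> ?R")
proof
  assume "graph_iso (star_graph 3) G"
  then obtain f :: "nat \<Rightarrow> 'a" where "bij_betw f {0, 1, 2, 3} (verts G)"
    "edges G = (`) f ` {{0, 1}, {0, 2}, {0, 3}}"
    unfolding graph_iso_def edges_star_graph verts_small_graphs by blast
  then have "distinct [f 0, f 1, f 2, f 3]"
    "G = \<lparr>verts = {f 0, f 1, f 2, f 3}, edges = {{f 0, f 1}, {f 0, f 2}, {f 0, f 3}}\<rparr>"
    by (auto simp: bij_betw_def)
  then show ?R by blast
next
  assume ?R
  then obtain a b c d where abcd: "distinct [a, b, c, d]"
    "G = \<lparr>verts = {a, b, c, d}, edges = {{a, b}, {a, c}, {a, d}}\<rparr>" by blast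
  show "graph_iso (star_graph 3) G"
    unfolding graph_iso_def edges_star_graph verts_small_graphs
    by (rule exI[of _ "\<lambda>i. [a, b, c, d] ! i"]) (use abcd in \<open>auto simp: bij_betw_def\<close>)
qed

text \<open>With the whole vertex set as witness, 3n \<le> 2n + 4 is exactly n \<le> 4.\<close>

lemma small_tree_in_T_min:
  assumes "tree T" "2 \<le> card (verts T)" "card (verts T) \<le> 4"
  shows "T \<in> T_min"
  using double_dominating_min(2)[OF assms(1) tree_verts_double_dominating[OF assms(1,2)]] assms(3)
  by simp

lemma tree_family_subset_T_min: "T \<in> tree_family \<Longrightarrow> T \<in> T_min"
proof (induction rule: tree_family.induct)
  case (P2 T)
  then show ?case
    by (auto simp: graph_iso_P2_iff intro!: small_tree_in_T_min tree_P2)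
next
  case (P3 T)
  then show ?case
    by (auto simp: graph_iso_P3_iff intro!: small_tree_in_T_min tree_P3)
next
  case (P4 T)
  then show ?case
    by (auto simp: graph_iso_P4_iff intro!: small_tree_in_T_min tree_P4)
next
  case (K13 T)
  then show ?case
    by (auto simp: graph_iso_K13_iff intro!: small_tree_in_T_min tree_K13)
next
  case (op_a T1 T2 w S1 S2 w1 w2)
  then show ?case by (intro attach_pair_in_T_min) auto
next
  case (op_b T1 T2 w S1 S2 w1 w2)
  then show ?case by (intro attach_pair_in_T_min) auto
next
  case (op_c Ss Ts xs w)
  then show ?case by (intro attach_list_in_T_min[where Ss = Ss]) auto
qed

section \<open>Classification of the trees with at most four vertices\<close>

lemma tree_card_1:
  assumes "tree G" "card (verts G) = 1" "x \<in> verts G"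
  shows "G = \<lparr>verts = {x}, edges = {}\<rparr>"
proof -
  have v: "verts G = {x}"
    using assms(2,3) by (auto simp: card_1_singleton_iff)
  have False if "e \<in> edges G" for e
  proof -
    have "e \<subseteq> {x}" "card e = 2"
      using that treeD(1)[OF assms(1)] v by (auto simp: simple_graph_def)
    then show False
      using card_mono[of "{x}" e] by simp
  qed
  then have "edges G = {}" by blast
  then show ?thesis using v by simp
qed

text \<open>Reduces the classification of trees of order \<open>Suc m\<close> to the ways of writing
  \<open>m\<close> as a sum of positive branch orders.\<close>

lemma tree_root_branches:
  assumes "tree G" "w \<in> verts G" "card (verts G) = Suc m"
  obtains X T where "tree_branches w X T" "G = join w X T" "(\<Sum>x\<in>X. card (verts (T x))) = m"
    "card X \<le> m" "\<And>x. x \<in> X \<Longrightarrow> card (verts (T x)) \<ge> 1"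
proof -
  obtain T where T: "tree_branches w (nbhd G w) T" "G = join w (nbhd G w) T"
    using tree_eq_join[OF assms(1,2)] .
  interpret tree_branches w "nbhd G w" T by (fact T(1))
  have m: "(\<Sum>x\<in>nbhd G w. card (verts (T x))) = m"
    using card_verts_join T(2) assms(3) by simp
  have pos: "card (verts (T x)) \<ge> 1" if "x \<in> nbhd G w" for x
    using tree_card_pos[OF tree_T[OF that]] .
  then have "card (nbhd G w) \<le> m"
    unfolding m[symmetric] card_eq_sum by (rule sum_mono)
  then show thesis using that T m pos by blast
qed

text \<open>The vertex \<open>x\<close> is prescribed because it will be the root of a branch in
  larger trees.\<close>

lemma tree_card_2:
  assumes "tree G" "card (verts G) = 2" "x \<in> verts G"
  obtains y where "x \<noteq> y" "G = \<lparr>verts = {x, y}, edges = {{x, y}}\<rparr>"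
proof -
  have "card (verts G) = Suc 1" using assms(2) by simp
  from tree_root_branches[OF assms(1,3) this]
  obtain X T where T: "tree_branches x X T" "G = join x X T" "(\<Sum>x\<in>X. card (verts (T x))) = 1"
    "card X \<le> 1" by metis
  interpret tree_branches x X T by (fact T(1))
  have "X \<noteq> {}" using T(3) by auto
  then obtain y where X: "X = {y}"
    using T(4) finite_X by (metis card_1_singletonE card_0_eq le_less less_one)
  then have "T y = \<lparr>verts = {y}, edges = {}\<rparr>"
    using T(3) by (intro tree_card_1 tree_T root) auto
  then show thesis
    using that[of y] T(2) fresh[of y] X by (simp add: join_singleton)
qed

lemma tree_card_3:
  assumes "tree G" "card (verts G) = 3"
  obtains a b c where "distinct [a, b, c]" "G = \<lparr>verts = {a, b, c}, edges = {{a, b}, {b, c}}\<rparr>"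
proof -
  obtain w where w: "w \<in> verts G" using treeD(5)[OF assms(1)] by blast
  have "card (verts G) = Suc 2" using assms(2) by simp
  from tree_root_branches[OF assms(1) w this]
  obtain X T where T: "tree_branches w X T" "G = join w X T" "(\<Sum>x\<in>X. card (verts (T x))) = 2"
    "card X \<le> 2" and pos: "\<And>x. x \<in> X \<Longrightarrow> card (verts (T x)) \<ge> 1" by metis
  interpret tree_branches w X T by (fact T(1))
  have "X \<noteq> {}" using T(3) by auto
  then have "card X = 1 \<or> card X = 2"
    using T(4) finite_X card_0_eq[of X] by linarith
  then consider x where "X = {x}" | x y where "X = {x, y}" "x \<noteq> y"
    by (auto simp: card_1_singleton_iff card_2_iff)
  then show thesis
  proof cases
    case 1
    then have "card (verts (T x)) = 2" "x \<in> verts (T x)" "tree (T x)" "w \<notin> verts (T x)"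
      using T(3) root tree_T fresh by auto
    moreover from this obtain y where "x \<noteq> y" "T x = \<lparr>verts = {x, y}, edges = {{x, y}}\<rparr>"
      using tree_card_2 by metis
    ultimately show ?thesis
      using that[of w x y] T(2) 1 by (simp add: join_singleton)
  next
    case 2
    have "card (verts (T x)) = 1" "card (verts (T y)) = 1"
      using T(3) pos[of x] pos[of y] 2 by auto
    then have "T x = \<lparr>verts = {x}, edges = {}\<rparr>" "T y = \<lparr>verts = {y}, edges = {}\<rparr>"
      using 2 by (auto intro!: tree_card_1 tree_T root)
    moreover from this have "w \<noteq> x" "w \<noteq> y"
      using fresh[of x] fresh[of y] 2 by auto
    ultimately show ?thesis
      using that[of x w y] T(2) 2 by (simp add: join_image insert_commute)
  qed
qed

text \<open>The branch orders at an arbitrary vertex are 3, or 1 and 2, or 1, 1 and 1.\<close>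

lemma tree_card_4:
  assumes "tree G" "card (verts G) = 4"
  shows "graph_iso (path_graph 4) G \<or> graph_iso (star_graph 3) G"
proof -
  obtain w where w: "w \<in> verts G" using treeD(5)[OF assms(1)] by blast
  have "card (verts G) = Suc 3" using assms(2) by simp
  from tree_root_branches[OF assms(1) w this]
  obtain X T where T: "tree_branches w X T" "G = join w X T" "(\<Sum>x\<in>X. card (verts (T x))) = 3"
    "card X \<le> 3" and pos: "\<And>x. x \<in> X \<Longrightarrow> card (verts (T x)) \<ge> 1" by metis
  interpret tree_branches w X T by (fact T(1))
  have path: ?thesis if "distinct [a, b, c, d]"
    "G = \<lparr>verts = {a, b, c, d}, edges = {{a, b}, {b, c}, {c, d}}\<rparr>" for a b c d
    unfolding graph_iso_P4_iff using that by blast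
  have star: ?thesis if "distinct [a, b, c, d]"
    "G = \<lparr>verts = {a, b, c, d}, edges = {{a, b}, {a, c}, {a, d}}\<rparr>" for a b c d
    unfolding graph_iso_K13_iff using that by blast
  have two: ?thesis if X: "X = {x, y}" "x \<noteq> y" and 1: "card (verts (T x)) = 1" for x y
  proof -
    have Tx: "T x = \<lparr>verts = {x}, edges = {}\<rparr>"
      using X 1 by (auto intro!: tree_card_1 tree_T root)
    have "card (verts (T y)) = 2"
      using T(3) X 1 by simp
    then obtain z where z: "y \<noteq> z" "T y = \<lparr>verts = {y, z}, edges = {{y, z}}\<rparr>"
      using tree_card_2[of "T y" y] tree_T root X by blast
    have "distinct [x, w, y, z]"
      using fresh[of x] fresh[of y] disjoint[of x y x] X z Tx by auto
    then show ?thesis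
      using path[of x w y z] T(2) X Tx z by (simp add: join_image insert_commute)
  qed
  have "X \<noteq> {}" using T(3) by auto
  then have "card X = 1 \<or> card X = 2 \<or> card X = 3"
    using T(4) finite_X card_0_eq[of X] by linarith
  then consider x where "X = {x}" | x y where "X = {x, y}" "x \<noteq> y"
    | x y z where "X = {x, y, z}" "distinct [x, y, z]"
    by (auto simp: card_1_singleton_iff card_2_iff card_3_iff)
  then show ?thesis
  proof cases
    case 1
    then have x: "card (verts (T x)) = 3" "x \<in> verts (T x)" "tree (T x)" "w \<notin> verts (T x)"
      using T(3) root tree_T fresh by auto
    then obtain a b c where abc: "distinct [a, b, c]"
      "T x = \<lparr>verts = {a, b, c}, edges = {{a, b}, {b, c}}\<rparr>"
      using tree_card_3 by metis
    \<comment> \<open>Attaching \<open>w\<close> at an end of the three-vertex path gives a path, at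
      its middle a star.\<close>
    then consider "x = a" | "x = b" | "x = c"
      using x(2) by auto
    then show ?thesis
    proof cases
      case 1
      then show ?thesis
        using path[of w a b c] T(2) \<open>X = {x}\<close> abc x(4) by (simp add: join_singleton)
    next
      case 2
      then show ?thesis
        using star[of b w a c] T(2) \<open>X = {x}\<close> abc x(4) by (auto simp: join_singleton insert_commute)
    next
      case 3
      then show ?thesis
        using path[of w c b a] T(2) \<open>X = {x}\<close> abc x(4) by (auto simp: join_singleton insert_commute)
    qed
  next
    case 2
    then have "card (verts (T x)) = 1 \<or> card (verts (T y)) = 1"
      using T(3) pos[of x] pos[of y] by auto
    then show ?thesis
      using two[of x y] two[of y x] 2 by (auto simp: insert_commute)
  next
    case 3
    have "card (verts (T x)) = 1" "card (verts (T y)) = 1" "card (verts (T z)) = 1"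
      using T(3) pos[of x] pos[of y] pos[of z] 3 by auto
    then have sub: "T x = \<lparr>verts = {x}, edges = {}\<rparr>" "T y = \<lparr>verts = {y}, edges = {}\<rparr>"
      "T z = \<lparr>verts = {z}, edges = {}\<rparr>"
      using 3 by (auto intro!: tree_card_1 tree_T root)
    then have "distinct [w, x, y, z]"
      using fresh[of x] fresh[of y] fresh[of z] 3 by auto
    then show ?thesis
      using star[of w x y z] T(2) 3 sub by (simp add: join_image insert_commute)
  qed
qed

lemma small_tree_in_family:
  assumes "tree G" "2 \<le> card (verts G)" "card (verts G) \<le> 4"
  shows "G \<in> tree_family"
proof -
  consider "card (verts G) = 2" | "card (verts G) = 3" | "card (verts G) = 4"
    using assms(2,3) by linarith
  then show ?thesis
  proof cases
    case 1
    obtain x where "x \<in> verts G" using treeD(5)[OF assms(1)] by blast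
    then have "graph_iso (path_graph 2) G"
      unfolding graph_iso_P2_iff using tree_card_2[OF assms(1) 1] by metis
    then show ?thesis by (rule tree_family.P2)
  next
    case 2
    then have "graph_iso (path_graph 3) G"
      unfolding graph_iso_P3_iff using tree_card_3[OF assms(1)] by metis
    then show ?thesis by (rule tree_family.P3)
  next
    case 3
    then show ?thesis
      using tree_card_4[OF assms(1)] tree_family.P4 tree_family.K13 by blast
  qed
qed

section \<open>The family of extremal trees\<close>

text \<open>The residue pairs appear in the order that the operations prescribe; (0,0) and (1,2)
  fall under \<open>op_c\<close>, where both roots count towards |N(w) \<inter> S|.\<close>

lemma join_pair_in_family:
  assumes branches: "tree_branches w {a, b} T" and ne: "a \<noteq> b"
    and T: "T a \<in> tree_family" "T a \<in> T_min" "T b \<in> tree_family" "T b \<in> T_min"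
    and S: "min_red_ld_set (T a) (S a)" "min_red_ld_set (T b) (S b)" "a \<in> S a" "b \<in> S b"
    and sizes: "(card (verts (T a)) mod 3, card (verts (T b)) mod 3) \<in> {(2, 2), (0, 2), (0, 0), (1, 2)}"
  shows "join w {a, b} T \<in> tree_family"
proof -
  interpret tree_branches w "{a, b}" T by (fact branches)
  have eq: "join w {a, b} T = attach w [T a, T b] [a, b]"
    using attach_map_eq_join[of w T "[a, b]"] by simp
  have disj: "verts (T a) \<inter> verts (T b) = {}" and w: "w \<notin> verts (T a) \<union> verts (T b)"
    using disjoint[of a b] fresh ne by auto
  consider (a) "card (verts (T a)) mod 3 = 2" "card (verts (T b)) mod 3 = 2"
    | (b) "card (verts (T a)) mod 3 = 0" "card (verts (T b)) mod 3 = 2"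
    | (c) "[card (verts (T a)) mod 3, card (verts (T b)) mod 3] \<in> {[0, 0], [1, 2], [2, 2, 2]}"
    using sizes by auto
  then show ?thesis
  proof cases
    case a
    show ?thesis
      unfolding eq by (rule tree_family.op_a[OF T disj w S(1,2) a S(3,4)])
  next
    case b
    show ?thesis
      unfolding eq by (rule tree_family.op_b[OF T disj w S(1,2) b S(3,4)])
  next
    case c
    have "{a, b} \<subseteq> nbhd (attach w [T a, T b] [a, b]) w \<inter> (S a \<union> S b)"
      using adj_join_root root S(3,4) unfolding eq[symmetric] nbhd_def verts_join by auto
    moreover have "finite (nbhd (attach w [T a, T b] [a, b]) w \<inter> (S a \<union> S b))"
      using treeD(4)[OF tree_join] unfolding eq[symmetric] nbhd_def by simp
    ultimately have "2 \<le> card (nbhd (attach w [T a, T b] [a, b]) w \<inter> (S a \<union> S b))"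
      using card_mono[of _ "{a, b}"] ne by fastforce
    then show ?thesis
      unfolding eq
      using T S c disj w root
      by (intro tree_family.op_c[where Ss = "[S a, S b]"])
        (auto simp: less_Suc_eq Int_commute)
  qed
qed

text \<open>Two roots in their sets already give |N(w) \<inter> S| \<ge> 2; the third may be any
  vertex of its branch.\<close>

lemma join_triple_in_family:
  assumes branches: "tree_branches w {a, b, c} T" and dist: "distinct [a, b, c]"
    and T: "\<And>x. x \<in> {a, b, c} \<Longrightarrow> T x \<in> tree_family \<and> T x \<in> T_min \<and> min_red_ld_set (T x) (S x)"
    and S: "a \<in> S a" "b \<in> S b"
    and sizes: "\<And>x. x \<in> {a, b, c} \<Longrightarrow> card (verts (T x)) mod 3 = 2"
  shows "join w {a, b, c} T \<in> tree_family"
proof -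
  interpret tree_branches w "{a, b, c}" T by (fact branches)
  have eq: "join w {a, b, c} T = attach w [T a, T b, T c] [a, b, c]"
    using attach_map_eq_join[of w T "[a, b, c]"] by simp
  have disj: "verts (T a) \<inter> verts (T b) = {}" "verts (T a) \<inter> verts (T c) = {}"
    "verts (T b) \<inter> verts (T c) = {}"
    using disjoint[of a b] disjoint[of a c] disjoint[of b c] dist by auto
  let ?N = "nbhd (attach w [T a, T b, T c] [a, b, c]) w \<inter> (S a \<union> (S b \<union> S c))"
  have "{a, b} \<subseteq> ?N"
    using adj_join_root root S unfolding eq[symmetric] nbhd_def verts_join by auto
  moreover have "finite ?N"
    using treeD(4)[OF tree_join] unfolding eq[symmetric] nbhd_def by simp
  ultimately have "2 \<le> card ?N"
    using card_mono[of _ "{a, b}"] dist by fastforce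
  then show ?thesis
    unfolding eq
    using T sizes disj root fresh
    by (intro tree_family.op_c[where Ss = "[S a, S b, S c]"])
      (auto simp: less_Suc_eq Int_commute)
qed

lemma T_min_subset_tree_family: "T \<in> T_min \<Longrightarrow> T \<in> tree_family"
proof (induction "card (verts T)" arbitrary: T rule: less_induct)
  case (less G)
  then have G: "tree G" "2 \<le> card (verts G)" by (auto simp: T_min_def)
  obtain S where S: "double_dominating G S" "3 * card S \<le> 2 * card (verts G) + 4"
    using T_min_obtain[OF less.prems] .
  show ?case
  proof (cases "verts G \<subseteq> S")
    case True
    then have "S = verts G"
      using S(1) by (auto simp: double_dominating_def)
    then show ?thesis
      \<comment> \<open>Here 3n \<le> 2n + 4, so G is one of the base trees.\<close>
      using small_tree_in_family[OF G] S(2) by simp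
  next
    case False
    then obtain w where "w \<in> verts G" "w \<notin> S" by blast
    from double_dominating_split[OF G(1) S(1) this]
    obtain X T a b where T: "tree_branches w X T" "G = join w X T" "S \<subseteq> (\<Union>x\<in>X. verts (T x))"
      and dd: "\<And>x. x \<in> X \<Longrightarrow> double_dominating (T x) (S \<inter> verts (T x))"
      and ab: "a \<in> S" "a \<in> X" "b \<in> S" "b \<in> X" "a \<noteq> b"
      by metis
    interpret tree_branches w X T by (fact T(1))
    define R where "R x = S \<inter> verts (T x)" for x
    \<comment> \<open>the excess of a branch over the lower bound, which also determines its order modulo 3\<close>
    define e where "e x = 3 * card (R x) - (2 * card (verts (T x)) + 2)" for x
    \<comment> \<open>By the lower bound the truncated subtraction in \<open>e\<close> is
      exact.\<close>
    have e: "3 * card (R x) = 2 * card (verts (T x)) + 2 + e x" if "x \<in> X" for x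
      using double_dominating_lower_bound[OF tree_T[OF that] dd[OF that]]
      by (simp add: e_def R_def)
    have n: "card (verts G) = Suc (\<Sum>x\<in>X. card (verts (T x)))"
      using card_verts_join T(2) by simp
    have "3 * card S = (\<Sum>x\<in>X. 3 * card (R x))"
      unfolding card_subset_branches[OF T(3)] R_def by (simp add: sum_distrib_left)
    also have "\<dots> = (\<Sum>x\<in>X. 2 * card (verts (T x)) + 2 + e x)"
      using e by (intro sum.cong) auto
    also have "\<dots> = 2 * (\<Sum>x\<in>X. card (verts (T x))) + 2 * card X + (\<Sum>x\<in>X. e x)"
      by (simp only: sum.distrib sum_distrib_left) simp
    finally have excess: "2 * card X + (\<Sum>x\<in>X. e x) \<le> 6"
      using S(2) n by simp
    have "card {a, b} \<le> card X"
      using finite_X ab by (intro card_mono) auto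
    then have cardX: "2 \<le> card X" using ab by simp
    have branch: "T x \<in> tree_family \<and> T x \<in> T_min \<and> min_red_ld_set (T x) (R x)" if x: "x \<in> X" for x
    proof -
      \<comment> \<open>At least two branches use up 4 of the 6 in \<open>excess\<close>. A branch
        with excess at most 2 is extremal, with \<open>R x\<close> as a minimum set, and smaller
        than \<open>G\<close>, so the induction hypothesis applies.\<close>
      have "e x \<le> 2"
        using member_le_sum[OF x, of e] finite_X excess cardX by simp
      then have min: "min_red_ld_set (T x) (R x)" "T x \<in> T_min"
        using double_dominating_min[OF tree_T[OF x] dd[OF x]] e[OF x] by (auto simp: R_def)
      moreover have "card (verts (T x)) < card (verts G)"
        unfolding n using member_le_sum[OF x, of "\<lambda>x. card (verts (T x))"] finite_X by simp
      ultimately show ?thesis using less.hyps by blast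
    qed
    have aR: "a \<in> R a" "b \<in> R b"
      using ab root by (auto simp: R_def)
    show ?thesis
    proof (cases "card X = 2")
      case True
      then have X: "X = {a, b}"
        using card_subset_eq[OF finite_X, of "{a, b}"] ab by simp
      then have "e a + e b \<le> 2"
        using excess ab by simp
      then have "e a = 0 \<and> e b \<le> 2 \<or> e a = 1 \<and> e b \<le> 1 \<or> e a = 2 \<and> e b = 0"
        by linarith
      moreover have residue: "(e x = 0 \<longrightarrow> card (verts (T x)) mod 3 = 2) \<and>
          (e x = 1 \<longrightarrow> card (verts (T x)) mod 3 = 0) \<and> (e x = 2 \<longrightarrow> card (verts (T x)) mod 3 = 1)"
        if "x \<in> X" for x
        using e[OF that] by presburger
      \<comment> \<open>Up to exchanging \<open>a\<close> and \<open>b\<close>, the excess pairs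
        (0,0), (1,0), (1,1), (2,0) become the residue pairs (2,2), (0,2), (0,0), (1,2).\<close>
      ultimately consider
        "(card (verts (T a)) mod 3, card (verts (T b)) mod 3) \<in> {(2, 2), (0, 2), (0, 0), (1, 2)}"
        | "(card (verts (T b)) mod 3, card (verts (T a)) mod 3) \<in> {(2, 2), (0, 2), (0, 0), (1, 2)}"
        using residue[OF ab(2)] residue[OF ab(4)] by (auto simp: le_Suc_eq numeral_2_eq_2)
      then show ?thesis
      proof cases
        case 1
        then show ?thesis
          using join_pair_in_family[of w a b T R] T(1,2) X ab branch aR by auto
      next
        case 2
        then show ?thesis
          using join_pair_in_family[of w b a T R] T(1,2) X ab branch aR by (auto simp: insert_commute)
      qed
    next
      case False
      \<comment> \<open>Three branches exhaust the 6 in \<open>excess\<close>, so every branch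
        attains the lower bound exactly and has residue 2.\<close>
      then have 3: "card X = 3" and "(\<Sum>x\<in>X. e x) = 0"
        using excess cardX by auto
      then have e0: "e x = 0" if "x \<in> X" for x
        using finite_X that by simp
      have "card (X - {a, b}) = 1"
        using 3 finite_X ab by (simp add: card_Diff_subset)
      then obtain c where "X - {a, b} = {c}"
        by (rule card_1_singletonE)
      then have X: "X = {a, b, c}" "distinct [a, b, c]"
        using ab by auto
      have "card (verts (T x)) mod 3 = 2" if "x \<in> X" for x
        using e[OF that] e0[OF that] by presburger
      then show ?thesis
        using join_triple_in_family[of w a b c T R] T(1,2) X branch aR by auto
    qed
  qed
qed

theorem theorem14:
  shows "(tree_family :: 'a graph set) = T_min"
  using tree_family_subset_T_min T_min_subset_tree_family by blast

end
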